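(* Let $N_1$ and $N_2$ be prime numbers with $N_1 \neq N_2$. Then every binary matrix $X$ of size $N_1 \times N_2$ is uniquely determined, among all $N_1\times N_2$ binary matrices, by its four DFT coefficients $\tilde X_{00}$, $\tilde X_{10}$, $\tilde X_{01}$, $\tilde X_{11}$. That is, if $X$ and $Y$ are $N_1 \times N_2$ binary matrices such that $$\tilde X_{00} = \tilde Y_{00},\quad \tilde X_{10} = \tilde Y_{10},\quad \tilde X_{01} = \tilde Y_{01},\quad \tilde X_{11} = \tilde Y_{11},$$ then $X = Y$.
   Context: A binary matrix is a matrix all of whose entries are $0$ or $1$. For an $N_1\times N_2$ matrix $X = (X_{mn})_{1\le m\le N_1,\ 1\le n\le N_2}$ and integers $k,l$, the (two-dimensional) discrete Fourier transform (DFT) coefficient is $$\tilde X_{kl} = \sum_{m=1}^{N_1}\sum_{n=1}^{N_2} X_{mn}\, e^{2\pi \mathrm{i}\,(mk/N_1 + nl/N_2)} \in \mathbb{C}.$$ *)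

theory Defs
  imports
    Complex_Main
    "HOL-Computational_Algebra.Primes"
    "Jordan_Normal_Form.Matrix"
begin

definition binary_mat :: "complex mat \<Rightarrow> bool" where
  "binary_mat X \<longleftrightarrow> elements_mat X \<subseteq> {0, 1}"

text \<open>The rows and columns are numbered from 1, as in the usual definition of the transform, with
  the positive sign and no normalisation factor. Library matrices are indexed from 0, hence the
  shift: the entry in row \<open>m\<close> and column \<open>n\<close> is \<open>X $$ (m - 1, n - 1)\<close>.\<close>

definition dft_coeff :: "complex mat \<Rightarrow> int \<Rightarrow> int \<Rightarrow> complex" where
  "dft_coeff X k l =
    (\<Sum>m = 1..dim_row X. \<Sum>n = 1..dim_col X.
      X $$ (m - 1, n - 1) *
      exp (2 * complex_of_real pi * \<i> *
        (of_nat m * of_int k / of_nat (dim_row X) + of_nat n * of_int l / of_nat (dim_col X))))"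

end

theory Submission
  imports Defs "HOL-Number_Theory.Cong" "Jordan_Normal_Form.Char_Poly"
begin

text \<open>The difference of two binary matrices is an integer array \<open>a\<close>, and the transform of \<open>a\<close>
  vanishes at \<open>(0, 0)\<close>, \<open>(1, 0)\<close>, \<open>(0, 1)\<close> and \<open>(1, 1)\<close>. Write \<open>z\<close> for a primitive root of unity of
  order \<open>N1 * N2\<close>. Every coefficient of the transform is the value at \<open>z\<close> of a polynomial with integer
  coefficients, and replacing \<open>z\<close> by \<open>z ^ t\<close> turns the coefficient at \<open>(k, l)\<close> into the one at
  \<open>(t * k, t * l)\<close>. An integer polynomial that vanishes at \<open>z\<close> also vanishes at \<open>z ^ t\<close> whenever \<open>t\<close> is
  coprime to \<open>N1 * N2\<close> (\<open>poly_root_of_unity_conjugate\<close>), so the zeros of the transform are closed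
  under scaling by such \<open>t\<close>. As \<open>N1\<close> and \<open>N2\<close> are distinct primes, the Chinese remainder theorem shows
  that the four given positions represent all orbits of this scaling: one for each choice of which
  of the two coordinates are zero. Hence the whole transform of \<open>a\<close> vanishes, and \<open>a = 0\<close> by
  injectivity of the Fourier transform.

  The statement on conjugates is equivalent to the irreducibility of the cyclotomic polynomials. The
  proof follows an idea of Landau. Let \<open>G(z ^ a) = 0\<close> and let \<open>r\<close> be prime. Modulo \<open>r\<close>, the polynomial
  \<open>G(x ^ r)\<close> is \<open>G(x) ^ r\<close>, so \<open>G(z ^ (r * a))\<close> is \<open>r\<close> times an element of \<open>\<int>[z]\<close>. A nonzero element of
  \<open>\<int>[z]\<close> is divisible by only finitely many primes (\<open>ex_prime_bound_dividing_value\<close>), and only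
  finitely many values \<open>G(z ^ b)\<close> exist since \<open>z\<close> is a root of unity. Therefore \<open>G(z ^ (r * a)) = 0\<close> for
  all large primes \<open>r\<close>. This suffices because every residue class coprime to the order of \<open>z\<close> contains
  a number without small prime factors (\<open>ex_cong_no_small_prime_factor\<close>).\<close>

section \<open>Values of integer polynomials\<close>

text \<open>Choose a nonzero integer polynomial \<open>f\<close> of least degree with \<open>f(z) = 0\<close>. Up to a power of its
  leading coefficient \<open>c\<close>, every value at \<open>z\<close> is the value of a polynomial of degree less than
  \<open>degree f\<close>, and such a representation is unique. So if \<open>r\<close> divides \<open>G(z)\<close>, then \<open>r\<close> divides all
  coefficients of a fixed nonzero polynomial \<open>R\<close> representing \<open>G(z)\<close>, up to powers of \<open>c\<close>. These powers
  come from pseudo-division by \<open>f\<close> and are harmless for primes \<open>r\<close> larger than \<open>\<bar>c\<bar>\<close>.\<close>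

lemma ex_prime_bound_dividing_value:
  fixes z :: "'a :: field_char_0" and P G :: "int poly"
  assumes "P \<noteq> 0" "poly (of_int_poly P) z = 0" "poly (of_int_poly G) z \<noteq> 0"
  shows "\<exists>B. \<forall>r>B. prime r \<longrightarrow> (\<forall>H. poly (of_int_poly G) z \<noteq> of_nat r * poly (of_int_poly H) z)"
proof -
  define ev :: "int poly \<Rightarrow> 'a" where "ev = (\<lambda>F. poly (of_int_poly F) z)"
  have ev_simps: "ev (F + F') = ev F + ev F'" "ev (F - F') = ev F - ev F'" "ev (F * F') = ev F * ev F'"
    "ev (smult a F) = of_int a * ev F" for F F' a
    by (simp_all add: ev_def hom_distribs)
  obtain f where f: "f \<noteq> 0" "ev f = 0"
    and minimal: "\<And>g. g \<noteq> 0 \<Longrightarrow> ev g = 0 \<Longrightarrow> degree f \<le> degree g"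
    using ex_has_least_nat[of "\<lambda>f. f \<noteq> 0 \<and> ev f = 0" P degree] assms(1,2)
    by (auto simp: ev_def)
  define c where "c = lead_coeff f"
  have c: "c \<noteq> 0" using f by (simp add: c_def)
  have small_eq_0: "g = 0" if "g = 0 \<or> degree g < degree f" "ev g = 0" for g
    using minimal[of g] that by force
  have reduce: "\<exists>k R. of_int (c ^ k) * ev F = ev R \<and> (R = 0 \<or> degree R < degree f)" for F
  proof -
    obtain q R where qR: "pseudo_divmod F f = (q, R)" by fastforce
    from pseudo_divmod[OF f(1) qR] f(2) show ?thesis
      by (metis c_def ev_simps(1,3,4) mult_zero_left add_0)
  qed
  obtain m R where R: "of_int (c ^ m) * ev G = ev R" "R = 0 \<or> degree R < degree f"
    using reduce by blast
  have "ev R \<noteq> 0"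
    using R(1) c assms(3) unfolding ev_def by (metis mult_eq_0_iff of_int_eq_0_iff power_not_zero)
  then have "R \<noteq> 0" by (auto simp: ev_def)
  define B where "B = nat (\<bar>c\<bar> + \<bar>lead_coeff R\<bar>)"
  have "ev G \<noteq> of_nat r * ev H" if r: "r > B" "prime r" for r H
  proof
    assume eq: "ev G = of_nat r * ev H"
    obtain k S where S: "of_int (c ^ k) * ev H = ev S" "S = 0 \<or> degree S < degree f"
      using reduce by blast
    \<comment> \<open>The two representations of \<open>c ^ (k + m) * ev G\<close> have small degree, so they coincide.\<close>
    define T where "T = smult (c ^ k) R - smult (int r * c ^ m) S"
    have "ev T = of_int (c ^ k) * (of_int (c ^ m) * ev G) - of_nat r * of_int (c ^ m) * (of_int (c ^ k) * ev H)"
      unfolding T_def ev_simps R(1) S(1) by simp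
    also have "\<dots> = 0" by (simp add: eq)
    finally have "ev T = 0" .
    moreover have "T = 0 \<or> degree T < degree f"
      unfolding T_def using R(2) S(2)
      by (metis degree_diff_less degree_smult_le diff_0 diff_zero degree_minus order_le_less_trans smult_0_right)
    ultimately have "T = 0" by (rule small_eq_0[rotated])
    then have "smult (c ^ k) R = smult (int r * c ^ m) S" by (simp add: T_def)
    then have "c ^ k * lead_coeff R = int r * c ^ m * coeff S (degree R)"
      by (metis coeff_smult)
    then have "int r dvd c ^ k * lead_coeff R" by (metis dvd_triv_left mult.assoc)
    then have "int r dvd c \<or> int r dvd lead_coeff R"
      using r(2) by (meson prime_dvd_mult_iff prime_dvd_power prime_nat_int_transfer)
    moreover have "lead_coeff R \<noteq> 0" using \<open>R \<noteq> 0\<close> by simp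
    ultimately have "int r \<le> \<bar>c\<bar> \<or> int r \<le> \<bar>lead_coeff R\<bar>"
      using c by (meson dvd_abs_iff zdvd_imp_le zero_less_abs_iff)
    then show False using r(1) unfolding B_def by linarith
  qed
  then show ?thesis unfolding ev_def by blast
qed

lemma prime_dvd_power_add_diff:
  fixes a b :: "'a :: comm_ring_1"
  assumes "prime r"
  shows "of_nat r dvd (a + b) ^ r - (a ^ r + b ^ r)"
proof -
  have "r > 0" using assms by (rule prime_gt_0_nat)
  let ?t = "\<lambda>k. of_nat (r choose k) * a ^ k * b ^ (r - k)"
  have "(a + b) ^ r = (\<Sum>k\<le>r. ?t k)" by (rule binomial_ring)
  also have "\<dots> = (\<Sum>k\<in>{..r} - {0, r}. ?t k) + (\<Sum>k\<in>{0, r}. ?t k)"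
    by (rule sum.subset_diff) auto
  also have "(\<Sum>k\<in>{0, r}. ?t k) = a ^ r + b ^ r"
    using \<open>r > 0\<close> by simp
  finally have "(a + b) ^ r - (a ^ r + b ^ r) = (\<Sum>k\<in>{..r} - {0, r}. ?t k)"
    by simp
  moreover have "of_nat r dvd ?t k" if "k \<in> {..r} - {0, r}" for k
  proof -
    have "r dvd (r choose k)"
      by (rule dvd_choose_prime) (use that assms in auto)
    then have "(of_nat r :: 'a) dvd of_nat (r choose k)" by (metis dvd_def of_nat_mult)
    then show ?thesis by (simp add: mult.assoc)
  qed
  ultimately show ?thesis by (metis (no_types, lifting) dvd_sum)
qed

lemma prime_dvd_power_diff_self:
  fixes a :: int
  assumes "prime r"
  shows "int r dvd a ^ r - a"
proof -
  have r: "r > 0" using assms by (rule prime_gt_0_nat)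
  have nonneg: "int r dvd int n ^ r - int n" for n
  proof (induction n)
    case (Suc n)
    have "int r dvd ((int n + 1) ^ r - (int n ^ r + 1 ^ r)) + (int n ^ r - int n)"
      by (intro dvd_add Suc) (use prime_dvd_power_add_diff[OF assms, of "int n" 1] in simp)
    then show ?case by (simp add: algebra_simps)
  qed (use r in \<open>simp add: power_0_left\<close>)
  obtain n where n: "int r dvd a - int n"
    using r by (intro that[of "nat (a mod int r)"]) (simp add: mod_eq_dvd_iff[symmetric])
  then have "[a = int n] (mod int r)" by (simp add: cong_iff_dvd_diff)
  then have "[a ^ r = int n ^ r] (mod int r)" by (rule cong_pow)
  with n nonneg[of n] have "int r dvd (a ^ r - int n ^ r) + (int n ^ r - int n) - (a - int n)"
    by (intro dvd_diff[OF dvd_add]) (simp_all add: cong_iff_dvd_diff)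
  then show ?thesis by simp
qed

text \<open>This is the identity \<open>G(x) ^ r = G(x ^ r)\<close> over the field with \<open>r\<close> elements. It is proved along
  the decomposition \<open>G = a + x * G'\<close>, with Fermat's little theorem for the constant \<open>a\<close>.\<close>

lemma prime_dvd_power_diff_pcompose:
  fixes G :: "int poly"
  assumes "prime r"
  shows "of_nat r dvd G ^ r - pcompose G (monom 1 r)"
proof (induction G)
  case 0
  then show ?case using prime_gt_0_nat[OF assms] by (simp add: power_0_left)
next
  case (pCons a G)
  have "of_nat r dvd ([:a:] + monom 1 1 * G) ^ r - ([:a:] ^ r + (monom 1 1 * G) ^ r)"
    by (rule prime_dvd_power_add_diff[OF assms])
  moreover have "of_nat r dvd [:a:] ^ r - [:a:]"
    using prime_dvd_power_diff_self[OF assms, of a]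
    by (simp add: poly_const_pow of_nat_poly)
  moreover have "of_nat r dvd monom 1 r * (G ^ r - pcompose G (monom 1 r))"
    by (intro dvd_mult pCons)
  ultimately have "of_nat r dvd ([:a:] + monom 1 1 * G) ^ r - ([:a:] ^ r + (monom 1 1 * G) ^ r)
      + ([:a:] ^ r - [:a:]) + monom 1 r * (G ^ r - pcompose G (monom 1 r))"
    by (intro dvd_add)
  also have "\<dots> = ([:a:] + monom 1 1 * G) ^ r - ([:a:] + monom 1 r * pcompose G (monom 1 r))"
    by (simp add: power_mult_distrib monom_power algebra_simps)
  also have "[:a:] + monom 1 1 * G = pCons a G"
    by (simp add: monom_Suc)
  also have "[:a:] + monom 1 r * pcompose G (monom 1 r) = pcompose (pCons a G) (monom 1 r)"
    by (simp add: pcompose_pCons)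
  finally show ?case .
qed

lemma poly_power_prime_eq:
  fixes z :: "'a :: comm_ring_1" and G :: "int poly"
  assumes "prime r"
  obtains H where "poly (of_int_poly G) z ^ r = poly (of_int_poly G) (z ^ r) + of_nat r * poly (of_int_poly H) z"
proof -
  obtain H where "G ^ r - pcompose G (monom 1 r) = of_nat r * H"
    using prime_dvd_power_diff_pcompose[OF assms] by (metis dvd_def)
  then have "G ^ r = pcompose G (monom 1 r) + of_nat r * H" by (simp add: algebra_simps)
  then have "poly (of_int_poly (G ^ r)) z = poly (of_int_poly (pcompose G (monom 1 r) + of_nat r * H)) z"
    by (rule arg_cong)
  then have "poly (of_int_poly G) z ^ r = poly (of_int_poly G) (z ^ r) + of_nat r * poly (of_int_poly H) z"
    by (simp add: hom_distribs of_int_hom.map_poly_pcompose poly_pcompose poly_monom)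
  then show ?thesis by (rule that)
qed

section \<open>Conjugate roots of unity\<close>

lemma power_cong_root_of_unity:
  fixes z :: "'a :: monoid_mult"
  assumes "z ^ N = 1" "[a = b] (mod N)"
  shows "z ^ a = z ^ b"
proof -
  have "z ^ a = z ^ (a mod N)" for a
  proof -
    have "z ^ a = z ^ (N * (a div N) + a mod N)" by simp
    also have "\<dots> = z ^ (a mod N)"
      unfolding power_add power_mult assms(1) by simp
    finally show ?thesis .
  qed
  then show ?thesis using assms(2) unfolding cong_def by metis
qed

text \<open>Adding \<open>N\<close> times the product of the small primes that do not divide \<open>k\<close> works: each small prime
  then divides exactly one of the two summands. Coprimality enters for the primes dividing \<open>k\<close>, which
  must not divide \<open>N\<close>.\<close>

lemma ex_cong_no_small_prime_factor:
  fixes k N B :: nat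
  assumes "coprime k N" "N > 0"
  obtains k' where "[k' = k] (mod N)" "k' > 0" "\<And>r. prime r \<Longrightarrow> r dvd k' \<Longrightarrow> r > B"
proof -
  define A where "A = {r. prime r \<and> r \<le> B \<and> \<not> r dvd k}"
  have fin: "finite A" unfolding A_def by simp
  define k' where "k' = k + N * \<Prod>A"
  have "r > B" if r: "prime r" "r dvd k'" for r
  proof (rule ccontr)
    assume "\<not> r > B"
    show False
    proof (cases "r dvd k")
      case True
      then have "r dvd N * \<Prod>A" using r(2) unfolding k'_def by (simp add: dvd_add_right_iff)
      moreover have "\<not> r dvd N"
        using True assms(1) r(1) by (meson coprime_common_divisor not_prime_unit)
      ultimately have "r dvd \<Prod>A" using r(1) by (simp add: prime_dvd_mult_iff)
      then obtain s where "s \<in> A" "r dvd s"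
        using r(1) fin by (auto simp: prime_dvd_prod_iff)
      then show False using True r(1) unfolding A_def by (metis (mono_tags, lifting) mem_Collect_eq primes_dvd_imp_eq)
    next
      case False
      then have "r \<in> A" using r(1) \<open>\<not> r > B\<close> unfolding A_def by simp
      then have "r dvd \<Prod>A" using fin by (metis dvd_prod_eqI)
      then show False using False r(2) unfolding k'_def by (simp add: dvd_add_left_iff)
    qed
  qed
  moreover have "[k' = k] (mod N)" unfolding k'_def by (simp add: cong_def)
  moreover have "\<Prod>A > 0"
    by (rule prod_pos) (auto simp: A_def prime_gt_0_nat)
  then have "k' > 0" using assms(2) unfolding k'_def by simp
  ultimately show ?thesis using that by blast
qed

text \<open>The exponent is first replaced by a congruent one all of whose prime factors exceed the bound
  \<open>B\<close>; these primes are then applied one at a time. The bound has to serve every step at once, so it is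
  taken over all values \<open>G(z ^ b)\<close>, and divisibility is measured in \<open>\<int>[z]\<close> throughout, which contains
  \<open>\<int>[z ^ a]\<close> for all \<open>a\<close>.\<close>

theorem poly_root_of_unity_conjugate:
  fixes z :: "'a :: field_char_0" and G :: "int poly"
  assumes N: "N > 0" and z: "z ^ N = 1" and G: "poly (of_int_poly G) z = 0" and k: "coprime k N"
  shows "poly (of_int_poly G) (z ^ k) = 0"
proof -
  let ?P = "monom 1 N - 1 :: int poly"
  have "coeff ?P N = 1" using N by simp
  then have P0: "?P \<noteq> 0" by force
  have Pz: "poly (of_int_poly ?P) z = 0"
    by (simp add: hom_distribs poly_monom z)
  have "\<exists>B. \<forall>r>B. prime r \<longrightarrow> poly (of_int_poly G) (z ^ b) \<noteq> 0 \<longrightarrow>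
      (\<forall>H. poly (of_int_poly G) (z ^ b) \<noteq> of_nat r * poly (of_int_poly H) z)" for b
  proof (cases "poly (of_int_poly G) (z ^ b) = 0")
    case False
    have *: "poly (of_int_poly G) (z ^ b) = poly (of_int_poly (pcompose G (monom 1 b))) z"
      by (simp add: of_int_hom.map_poly_pcompose poly_pcompose poly_monom)
    show ?thesis
      using ex_prime_bound_dividing_value[OF P0 Pz, of "pcompose G (monom 1 b)"] False
      unfolding * by blast
  qed auto
  then obtain \<beta> where \<beta>: "\<And>b r H. r > \<beta> b \<Longrightarrow> prime r \<Longrightarrow> poly (of_int_poly G) (z ^ b) \<noteq> 0 \<Longrightarrow>
      poly (of_int_poly G) (z ^ b) \<noteq> of_nat r * poly (of_int_poly H) z"
    by metis
  define B where "B = Max (\<beta> ` {..<N})"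
  have step: "poly (of_int_poly G) (z ^ (r * a)) = 0"
    if r: "prime r" "r > B" and a: "poly (of_int_poly G) (z ^ a) = 0" for r a
  proof (rule ccontr)
    define b where "b = (r * a) mod N"
    have zb: "z ^ (r * a) = z ^ b"
      by (rule power_cong_root_of_unity[OF z]) (simp add: b_def cong_def)
    assume "poly (of_int_poly G) (z ^ (r * a)) \<noteq> 0"
    then have nz: "poly (of_int_poly G) (z ^ b) \<noteq> 0" by (simp add: zb)
    have "\<beta> b \<le> B" unfolding B_def b_def using N by (intro Max_ge) auto
    then have "r > \<beta> b" using r(2) by simp
    obtain H where "poly (of_int_poly G) (z ^ a) ^ r =
        poly (of_int_poly G) ((z ^ a) ^ r) + of_nat r * poly (of_int_poly H) (z ^ a)"
      using poly_power_prime_eq[OF r(1)] by blast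
    then have "poly (of_int_poly G) (z ^ b) = - (of_nat r * poly (of_int_poly H) (z ^ a))"
      using a prime_gt_0_nat[OF r(1)]
      by (simp add: zb[symmetric] power_mult[symmetric] mult.commute[of a r] eq_neg_iff_add_eq_0 power_0_left)
    also have "\<dots> = of_nat r * poly (of_int_poly (pcompose (- H) (monom 1 a))) z"
      by (simp add: of_int_hom.map_poly_pcompose poly_pcompose poly_monom hom_distribs)
    finally show False using \<beta>[OF \<open>r > \<beta> b\<close> r(1) nz] by blast
  qed
  obtain k' where k': "[k' = k] (mod N)" "k' > 0" "\<And>r. prime r \<Longrightarrow> r dvd k' \<Longrightarrow> r > B"
    using ex_cong_no_small_prime_factor[OF k N] by metis
  have "k' > 0 \<Longrightarrow> (\<And>r. prime r \<Longrightarrow> r dvd k' \<Longrightarrow> r > B) \<Longrightarrow> poly (of_int_poly G) (z ^ k') = 0"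
  proof (induction k' rule: prime_divisors_induct)
    case zero
    then show ?case by simp
  next
    case (unit x)
    then show ?case using G by simp
  next
    case (factor r x)
    then show ?case by (intro step) auto
  qed
  then have "poly (of_int_poly G) (z ^ k') = 0" using k'(2,3) by blast
  then show ?thesis
    using power_cong_root_of_unity[OF z k'(1)] by simp
qed

section \<open>Discrete Fourier transforms of integer arrays\<close>

lemma cis_root_of_unity: "n > 0 \<Longrightarrow> cis (2 * pi / real n) ^ n = 1"
  by (simp add: DeMoivre)

text \<open>The coefficients of the transform are, up to nonzero factors, the values at all \<open>N\<close>-th roots of
  unity of the polynomial of degree less than \<open>N\<close> with coefficients \<open>c 1, \<dots>, c N\<close>.\<close>

lemma dft_eq_0_imp_eq_0:
  fixes c :: "nat \<Rightarrow> complex"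
  assumes dft: "\<And>k. k < N \<Longrightarrow> (\<Sum>m = 1..N. c m * cis (2 * pi / real N) ^ (m * k)) = 0"
    and m: "m \<in> {1..N}"
  shows "c m = 0"
proof -
  have N: "N > 0" using m by simp
  define P where "P = (\<Sum>m = 1..N. monom (c m) (m - 1))"
  have coeff_P: "coeff P i = (if i < N then c (Suc i) else 0)" for i
  proof -
    have "coeff P i = (\<Sum>m = 1..N. if m = Suc i then c m else 0)"
      unfolding P_def coeff_sum by (intro sum.cong) auto
    then show ?thesis by auto
  qed
  have "P = 0"
  proof (rule poly_eqI_degree)
    fix z :: complex assume "z \<in> {z. z ^ N = 1}"
    then obtain k where k: "k < N" "z = cis (2 * pi * real k / real N)"
      using bij_betw_imp_surj_on[OF bij_betw_roots_unity[OF N]] by auto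
    then have z: "z = cis (2 * pi / real N) ^ k" by (simp add: DeMoivre mult.commute)
    have "z * poly P z = (\<Sum>m = 1..N. c m * cis (2 * pi / real N) ^ (m * k))"
      unfolding P_def poly_sum sum_distrib_left
    proof (intro sum.cong refl)
      fix m assume "m \<in> {1..N}"
      then obtain i where i: "m = Suc i" by (cases m) auto
      show "z * poly (monom (c m) (m - 1)) z = c m * cis (2 * pi / real N) ^ (m * k)"
        by (simp add: i z poly_monom power_mult[symmetric] power_add mult_ac)
    qed
    with dft[OF k(1)] have "z * poly P z = 0" by simp
    moreover have "z \<noteq> 0" by (simp add: k(2))
    ultimately show "poly P z = poly 0 z" by simp
  next
    have "degree P < N" using N coeff_P by (intro degree_lessI) auto
    then show "degree P < card {z :: complex. z ^ N = 1}" by (simp add: card_roots_unity_eq[OF N])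
    show "degree (0 :: complex poly) < card {z :: complex. z ^ N = 1}"
      using N by (simp add: card_roots_unity_eq[OF N])
  qed
  then have "coeff P (m - 1) = 0" by simp
  moreover have "m - 1 < N" "Suc (m - 1) = m" using m by auto
  ultimately show ?thesis unfolding coeff_P by simp
qed

definition array_dft :: "(nat \<Rightarrow> nat \<Rightarrow> int) \<Rightarrow> nat \<Rightarrow> nat \<Rightarrow> nat \<Rightarrow> nat \<Rightarrow> complex" where
  "array_dft a M N k l =
    (\<Sum>m = 1..M. \<Sum>n = 1..N.
      of_int (a m n) * cis (2 * pi / real M) ^ (m * k) * cis (2 * pi / real N) ^ (n * l))"

lemma array_dft_cong:
  assumes "M > 0" "N > 0" "[k = k'] (mod M)" "[l = l'] (mod N)"
  shows "array_dft a M N k l = array_dft a M N k' l'"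
proof -
  have "cis (2 * pi / real M) ^ (m * k) = cis (2 * pi / real M) ^ (m * k')" for m
    by (rule power_cong_root_of_unity[OF cis_root_of_unity[OF assms(1)]])
       (rule cong_scalar_left[OF assms(3)])
  moreover have "cis (2 * pi / real N) ^ (n * l) = cis (2 * pi / real N) ^ (n * l')" for n
    by (rule power_cong_root_of_unity[OF cis_root_of_unity[OF assms(2)]])
       (rule cong_scalar_left[OF assms(4)])
  ultimately show ?thesis unfolding array_dft_def by simp
qed

text \<open>With \<open>z\<close> a primitive root of unity of order \<open>M * N\<close>, the roots of unity for the two directions are
  \<open>z ^ N\<close> and \<open>z ^ M\<close>. So the coefficient at \<open>(s * k, s * l)\<close> is the value at \<open>z ^ s\<close> of one polynomial \<open>G\<close>
  that is independent of \<open>s\<close>.\<close>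

lemma array_dft_scale_eq_0:
  assumes M: "M > 0" and N: "N > 0" and t: "coprime t (M * N)" and 0: "array_dft a M N k l = 0"
  shows "array_dft a M N (t * k) (t * l) = 0"
proof -
  define z where "z = cis (2 * pi / real (M * N))"
  have z: "z ^ (M * N) = 1" unfolding z_def using M N by (intro cis_root_of_unity) simp
  have u: "cis (2 * pi / real M) = z ^ N" and v: "cis (2 * pi / real N) = z ^ M"
    using M N by (simp_all add: z_def DeMoivre)
  define G where "G = (\<Sum>m = 1..M. \<Sum>n = 1..N. monom (a m n) (N * (m * k) + M * (n * l)))"
  have G: "poly (of_int_poly G) (z ^ s) = array_dft a M N (s * k) (s * l)" for s
  proof -
    have "poly (of_int_poly G) (z ^ s) =
        (\<Sum>m = 1..M. \<Sum>n = 1..N. of_int (a m n) * (z ^ s) ^ (N * (m * k) + M * (n * l)))"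
      unfolding G_def by (simp add: hom_distribs poly_sum poly_monom)
    also have "\<dots> = array_dft a M N (s * k) (s * l)"
      unfolding array_dft_def u v
      by (intro sum.cong refl) (simp add: power_mult[symmetric] power_add[symmetric] algebra_simps)
    finally show ?thesis .
  qed
  have "poly (of_int_poly G) (z ^ t) = 0"
    by (rule poly_root_of_unity_conjugate[OF _ z _ t]) (use M N 0 G[of 1] in simp_all)
  then show ?thesis by (simp add: G)
qed

lemma array_dft_eq_0_imp_eq_0:
  assumes "\<And>k l. k < M \<Longrightarrow> l < N \<Longrightarrow> array_dft a M N k l = 0" and m: "m \<in> {1..M}" and n: "n \<in> {1..N}"
  shows "a m n = 0"
proof -
  have "(\<Sum>n = 1..N. complex_of_int (a m n) * cis (2 * pi / real N) ^ (n * l)) = 0" if l: "l < N" for l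
  proof (rule dft_eq_0_imp_eq_0[OF _ m])
    fix k assume "k < M"
    with l have "array_dft a M N k l = 0" by (rule assms(1)[rotated])
    then show "(\<Sum>m = 1..M. (\<Sum>n = 1..N. complex_of_int (a m n) * cis (2 * pi / real N) ^ (n * l)) *
        cis (2 * pi / real M) ^ (m * k)) = 0"
      unfolding array_dft_def sum_distrib_right by (simp only: mult_ac)
  qed
  then have "complex_of_int (a m n) = 0" by (rule dft_eq_0_imp_eq_0[OF _ n])
  then show ?thesis by simp
qed

text \<open>Each position \<open>(k, l)\<close> is a multiple \<open>(t * k0, t * l0)\<close> of a position with coordinates 0 and 1,
  where \<open>t\<close> is coprime to \<open>p * q\<close>.\<close>

theorem array_eq_0_if_four_dft_eq_0:
  fixes a :: "nat \<Rightarrow> nat \<Rightarrow> int"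
  assumes p: "prime p" and q: "prime q" and "p \<noteq> q"
    and zeros: "array_dft a p q 0 0 = 0" "array_dft a p q 1 0 = 0"
      "array_dft a p q 0 1 = 0" "array_dft a p q 1 1 = 0"
    and "m \<in> {1..p}" "n \<in> {1..q}"
  shows "a m n = 0"
proof (rule array_dft_eq_0_imp_eq_0)
  fix k l :: nat assume k: "k < p" and l: "l < q"
  have pos: "p > 0" "q > 0" using p q by (simp_all add: prime_gt_0_nat)
  have pq: "coprime p q" using p q \<open>p \<noteq> q\<close> by (rule primes_coprime)
  define k0 l0 :: nat where "k0 = (if k = 0 then 0 else 1)" and "l0 = (if l = 0 then 0 else 1)"
  \<comment> \<open>A zero coordinate imposes no condition on \<open>t\<close>; the value 1 keeps \<open>t\<close> prime to the modulus.\<close>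
  define k1 l1 where "k1 = (if k = 0 then 1 else k)" and "l1 = (if l = 0 then 1 else l)"
  obtain t where t: "[t = k1] (mod p)" "[t = l1] (mod q)"
    using binary_chinese_remainder_nat[OF pq] by blast
  have "\<not> p dvd k1" "\<not> q dvd l1"
    using k l prime_gt_1_nat[OF p] prime_gt_1_nat[OF q] by (auto simp: k1_def l1_def dest: dvd_imp_le)
  then have "\<not> p dvd t" "\<not> q dvd t"
    using t cong_dvd_iff by blast+
  then have "coprime t (p * q)"
    using p q by (simp add: prime_imp_coprime coprime_commute)
  moreover have "array_dft a p q k0 l0 = 0"
    using zeros by (simp add: k0_def l0_def)
  ultimately have "array_dft a p q (t * k0) (t * l0) = 0"
    using pos by (intro array_dft_scale_eq_0)
  moreover have "[t * k0 = k] (mod p)" "[t * l0 = l] (mod q)"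
    using t by (simp_all add: k0_def l0_def k1_def l1_def split: if_splits)
  ultimately show "array_dft a p q k l = 0"
    using array_dft_cong[OF pos] by simp
qed fact+

lemma dft_coeff_diff_eq_array_dft:
  assumes "X \<in> carrier_mat M N" "Y \<in> carrier_mat M N" "M > 0" "N > 0"
    and "\<And>m n. m \<in> {1..M} \<Longrightarrow> n \<in> {1..N} \<Longrightarrow>
      of_int (a m n) = X $$ (m - 1, n - 1) - Y $$ (m - 1, n - 1)"
  shows "dft_coeff X (int k) (int l) - dft_coeff Y (int k) (int l) = array_dft a M N k l"
proof -
  have e: "exp (2 * complex_of_real pi * \<i> *
      (of_nat m * of_int (int k) / of_nat M + of_nat n * of_int (int l) / of_nat N)) =
      cis (2 * pi / real M) ^ (m * k) * cis (2 * pi / real N) ^ (n * l)" for m n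
    unfolding DeMoivre cis_mult unfolding cis_conv_exp by (rule arg_cong[of _ _ exp]) (simp add: algebra_simps)
  have "X \<in> carrier_mat M N \<Longrightarrow> dft_coeff X (int k) (int l) = (\<Sum>m = 1..M. \<Sum>n = 1..N. X $$ (m - 1, n - 1) *
      (cis (2 * pi / real M) ^ (m * k) * cis (2 * pi / real N) ^ (n * l)))" for X
    unfolding dft_coeff_def by (simp only: e carrier_matD)
  then show ?thesis
    using assms(1,2) unfolding array_dft_def
    by (simp add: sum_subtractf[symmetric] assms(5) algebra_simps)
qed

theorem theorem5:
  fixes N1 N2 :: nat and X Y :: "complex mat"
  assumes "prime N1" and "prime N2" and "N1 \<noteq> N2"
    and "X \<in> carrier_mat N1 N2" and "binary_mat X"
    and "Y \<in> carrier_mat N1 N2" and "binary_mat Y"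
    and "dft_coeff X 0 0 = dft_coeff Y 0 0"
    and "dft_coeff X 1 0 = dft_coeff Y 1 0"
    and "dft_coeff X 0 1 = dft_coeff Y 0 1"
    and "dft_coeff X 1 1 = dft_coeff Y 1 1"
  shows "X = Y"
proof -
  have entry: "Z $$ (i, j) \<in> \<int>"
    if "Z \<in> carrier_mat N1 N2" "binary_mat Z" "i < N1" "j < N2" for Z i j
    using that elements_matI[OF that(1,3,4) refl] by (auto simp: binary_mat_def)
  define a where "a m n = \<lfloor>Re (X $$ (m - 1, n - 1) - Y $$ (m - 1, n - 1))\<rfloor>" for m n
  have a: "of_int (a m n) = X $$ (m - 1, n - 1) - Y $$ (m - 1, n - 1)"
    if "m \<in> {1..N1}" "n \<in> {1..N2}" for m n
  proof -
    have "X $$ (m - 1, n - 1) - Y $$ (m - 1, n - 1) \<in> \<int>"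
      using that assms(4-7) by (intro Ints_diff entry) auto
    then show ?thesis unfolding a_def by (elim Ints_cases) simp
  qed
  have pos: "N1 > 0" "N2 > 0" using assms(1,2) by (simp_all add: prime_gt_0_nat)
  have dft: "array_dft a N1 N2 k l = dft_coeff X (int k) (int l) - dft_coeff Y (int k) (int l)" for k l
    by (rule dft_coeff_diff_eq_array_dft[OF assms(4,6) pos, symmetric]) (rule a)
  have zeros: "array_dft a N1 N2 0 0 = 0" "array_dft a N1 N2 1 0 = 0"
    "array_dft a N1 N2 0 1 = 0" "array_dft a N1 N2 1 1 = 0"
    using assms(8-11) by (simp_all add: dft)
  show ?thesis
  proof (rule eq_matI)
    fix i j assume "i < dim_row Y" "j < dim_col Y"
    then have ij: "Suc i \<in> {1..N1}" "Suc j \<in> {1..N2}" using assms(6) by auto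
    then have "a (Suc i) (Suc j) = 0"
      using array_eq_0_if_four_dft_eq_0[OF assms(1-3) zeros] by blast
    then show "X $$ (i, j) = Y $$ (i, j)" using a[OF ij] by simp
  qed (use assms(4,6) in auto)
qed

end
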